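(* Consider the adjacent-categories logit model with partial proportional odds: $\log(\pi_{ij}/\pi_{i,j+1})=\mathbf h_j^T(\mathbf x_i)\boldsymbol\beta_j+\mathbf h_c^T(\mathbf x_i)\boldsymbol\zeta$ for $i=1,\dots,m$, $j=1,\dots,J-1$. Suppose $\mathbf h_1(\mathbf x_i)=\cdots=\mathbf h_{J-1}(\mathbf x_i)$ for all $i=1,\dots,m$. Then any order $\sigma_1$ (a permutation of $\{1,\dots,J\}$) is equivalent to its reverse order $\sigma_2$, which satisfies $\sigma_2(j)=\sigma_1(J+1-j)$ for all $j=1,\dots,J$; that is, $\sigma_1\sim\sigma_2$.
   Context: Setting. Let $d\ge1$, $m\ge1$, $J\ge3$. The data are $\{(\mathbf x_i,\mathbf Y_i): i=1,\dots,m\}$, where $\mathbf x_1,\dots,\mathbf x_m\in\mathbb R^d$ are distinct covariate settings and $\mathbf Y_i=(Y_{i1},\dots,Y_{iJ})^T$ is a vector of nonnegative integer counts with $n_i=\sum_{j=1}^JY_{ij}>0$. The model assumes $\mathbf Y_i\sim\mathrm{Multinomial}(n_i;\pi_{i1},\dots,\pi_{iJ})$ independently over $i$, with $\pi_{ij}>0$ and $\sum_{j=1}^J\pi_{ij}=1$. Model. $\mathbf h_j:\mathbb R^d\to\mathbb R^{p_j}$ ($j=1,\dots,J-1$) and $\mathbf h_c:\mathbb R^d\to\mathbb R^{p_c}$ are known predictor functions (under the hypothesis of the claim, all $p_j$ are equal), and the unknown parameter is $\boldsymbol\theta=(\boldsymbol\beta_1^T,\dots,\boldsymbol\beta_{J-1}^T,\boldsymbol\zeta^T)^T$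 with $\boldsymbol\beta_j\in\mathbb R^{p_j}$, $\boldsymbol\zeta\in\mathbb R^{p_c}$, ranging over $\boldsymbol\Theta=\mathbb R^p$, $p=p_1+\cdots+p_{J-1}+p_c$. For $\boldsymbol\theta\in\boldsymbol\Theta$, $(\pi_{i1}(\boldsymbol\theta),\dots,\pi_{iJ}(\boldsymbol\theta))$ denotes the unique positive probability vector satisfying the model equations at $\mathbf x_i$. Orders and equivalence. An order is a permutation $\sigma$ of $\{1,\dots,J\}$. Fitting the model with order $\sigma$ means fitting it to the permuted data $\mathbf Y_i^\sigma=(Y_{i\sigma(1)},\dots,Y_{i\sigma(J)})^T$, so the likelihood function with order $\sigma$ is $$L_\sigma(\boldsymbol\theta)=\prod_{i=1}^m\frac{n_i!}{\prod_{j=1}^JY_{i\sigma(j)}!}\prod_{j=1}^J\pi_{ij}(\boldsymbol\theta)^{Y_{i\sigma(j)}} .$$ Two orders are equivalent, $\sigma_1\sim\sigma_2$, if $\sup_{\boldsymbol\theta\in\boldsymbol\Theta}L_{\sigma_1}(\boldsymbol\theta)=\sup_{\boldsymbol\theta\in\boldsymbol\Theta}L_{\sigma_2}(\boldsymbol\theta)$. *)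

theory Defs
  imports Complex_Main "HOL-Library.FuncSet" "HOL-Combinatorics.Permutations"
    "Jordan_Normal_Form.Matrix"
begin

text \<open>
  Settings, response categories, coordinates of the predictor families and values of an order are
  indexed from 1, as functions on \<^typ>\<open>nat\<close> that matter only on the
  index range in question.  Euclidean vectors are \<^typ>\<open>real vec\<close>, whose entries are
  indexed from 0; an equation between them includes equality of the dimensions.
\<close>

definition positive_prob_vectors :: "nat \<Rightarrow> (nat \<Rightarrow> real) set" where
  "positive_prob_vectors J =
     {q \<in> extensional {1..J}. (\<forall>j\<in>{1..J}. q j > 0) \<and> (\<Sum>j=1..J. q j) = 1}"

text \<open>The parameter vector is the concatenation of the blocks
  \<open>\<beta>\<^sub>1, \<dots>, \<beta>\<^bsub>J-1\<^esub>, \<zeta>\<close> of dimensions \<open>p 1, \<dots>, p (J - 1), pc\<close>.\<close>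

definition param_space :: "nat \<Rightarrow> (nat \<Rightarrow> nat) \<Rightarrow> nat \<Rightarrow> real vec set" where
  "param_space J p pc = carrier_vec ((\<Sum>j=1..J-1. p j) + pc)"

definition beta_block :: "(nat \<Rightarrow> nat) \<Rightarrow> real vec \<Rightarrow> nat \<Rightarrow> real vec" where
  "beta_block p \<theta> j = vec (p j) (\<lambda>k. \<theta> $ ((\<Sum>l=1..<j. p l) + k))"

definition zeta_block :: "nat \<Rightarrow> (nat \<Rightarrow> nat) \<Rightarrow> nat \<Rightarrow> real vec \<Rightarrow> real vec" where
  "zeta_block J p pc \<theta> = vec pc (\<lambda>k. \<theta> $ ((\<Sum>l=1..J-1. p l) + k))"

definition adjacent_logit_ppo ::
  "nat \<Rightarrow> (nat \<Rightarrow> nat) \<Rightarrow> nat \<Rightarrow> (nat \<Rightarrow> real vec \<Rightarrow> real vec) \<Rightarrow> (real vec \<Rightarrow> real vec)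
    \<Rightarrow> real vec \<Rightarrow> real vec \<Rightarrow> (nat \<Rightarrow> real) \<Rightarrow> bool" where
  "adjacent_logit_ppo J p pc h hc \<theta> x q \<longleftrightarrow>
     (\<forall>j\<in>{1..J-1}. ln (q j / q (j + 1)) =
        h j x \<bullet> beta_block p \<theta> j + hc x \<bullet> zeta_block J p pc \<theta>)"

definition category_probs ::
  "nat \<Rightarrow> (nat \<Rightarrow> nat) \<Rightarrow> nat \<Rightarrow> (nat \<Rightarrow> real vec \<Rightarrow> real vec) \<Rightarrow> (real vec \<Rightarrow> real vec)
    \<Rightarrow> real vec \<Rightarrow> real vec \<Rightarrow> nat \<Rightarrow> real" where
  "category_probs J p pc h hc \<theta> x =
     (THE q. q \<in> positive_prob_vectors J \<and> adjacent_logit_ppo J p pc h hc \<theta> x q)"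

text \<open>In the next two definitions \<open>\<pi> \<theta> z\<close> is the vector of category probabilities
  which the fitted model assigns to the setting \<open>z\<close> under the parameter \<open>\<theta>\<close>.\<close>

definition likelihood ::
  "nat \<Rightarrow> nat \<Rightarrow> (nat \<Rightarrow> 'x) \<Rightarrow> (nat \<Rightarrow> nat \<Rightarrow> nat) \<Rightarrow> ('t \<Rightarrow> 'x \<Rightarrow> nat \<Rightarrow> real)
    \<Rightarrow> (nat \<Rightarrow> nat) \<Rightarrow> 't \<Rightarrow> real" where
  "likelihood m J x Y \<pi> \<sigma> \<theta> =
     (\<Prod>i=1..m. fact (\<Sum>j=1..J. Y i j) / (\<Prod>j=1..J. fact (Y i (\<sigma> j)))
        * (\<Prod>j=1..J. \<pi> \<theta> (x i) j ^ Y i (\<sigma> j)))"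

definition equivalent_orders ::
  "nat \<Rightarrow> nat \<Rightarrow> (nat \<Rightarrow> 'x) \<Rightarrow> (nat \<Rightarrow> nat \<Rightarrow> nat) \<Rightarrow> 't set \<Rightarrow> ('t \<Rightarrow> 'x \<Rightarrow> nat \<Rightarrow> real)
    \<Rightarrow> (nat \<Rightarrow> nat) \<Rightarrow> (nat \<Rightarrow> nat) \<Rightarrow> bool" where
  "equivalent_orders m J x Y \<Theta> \<pi> \<sigma>\<^sub>1 \<sigma>\<^sub>2 \<longleftrightarrow>
     (SUP \<theta>\<in>\<Theta>. likelihood m J x Y \<pi> \<sigma>\<^sub>1 \<theta>) = (SUP \<theta>\<in>\<Theta>. likelihood m J x Y \<pi> \<sigma>\<^sub>2 \<theta>)"

text \<open>The definite description in \<open>category_probs\<close> is proper, and the suprema in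
  \<open>equivalent_orders\<close> are taken over nonempty sets of reals which are bounded above.\<close>

lemma ex1_adjacent_logit_ppo:
  assumes "J \<ge> 1"
  shows "\<exists>!q. q \<in> positive_prob_vectors J \<and> adjacent_logit_ppo J p pc h hc \<theta> x q"
proof -
  define e where "e j = h j x \<bullet> beta_block p \<theta> j + hc x \<bullet> zeta_block J p pc \<theta>" for j
  define w where "w j = exp (\<Sum>l=j..<J. e l)" for j
  define W where "W = (\<Sum>j=1..J. w j)"
  have wpos: "w j > 0" for j
    by (simp add: w_def)
  have "W > 0"
    unfolding W_def using assms wpos by (intro sum_pos) auto
  have wrec: "w j = exp (e j) * w (j + 1)" if "j < J" for j
    using that by (simp add: w_def sum.atLeast_Suc_lessThan exp_add)
  define q where "q = (\<lambda>j\<in>{1..J}. w j / W)"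
  show ?thesis
  proof (rule ex1I[of _ q], intro conjI)
    show "q \<in> positive_prob_vectors J"
      using wpos \<open>W > 0\<close>
      by (auto simp: positive_prob_vectors_def q_def sum_divide_distrib[symmetric] W_def)
    show "adjacent_logit_ppo J p pc h hc \<theta> x q"
      unfolding adjacent_logit_ppo_def e_def[symmetric]
    proof
      fix j assume j: "j \<in> {1..J-1}"
      then have "q j / q (j + 1) = w j / w (j + 1)"
        using \<open>W > 0\<close> by (auto simp: q_def)
      also have "\<dots> = exp (e j)"
        using wrec[of j] wpos[of "j + 1"] j by auto
      finally show "ln (q j / q (j + 1)) = e j"
        by simp
    qed
  next
    fix r assume r: "r \<in> positive_prob_vectors J \<and> adjacent_logit_ppo J p pc h hc \<theta> x r"
    then have pos: "r j > 0" if "j \<in> {1..J}" for j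
      using that by (auto simp: positive_prob_vectors_def)
    have rw: "r j = r J * w j" if "j \<le> J" "1 \<le> j" for j
      using that
    proof (induction j rule: inc_induct)
      case base
      show ?case by (simp add: w_def)
    next
      case (step n)
      have n: "n \<in> {1..J-1}" using step by auto
      have "ln (r n / r (n + 1)) = e n"
        using r n by (auto simp: adjacent_logit_ppo_def e_def)
      moreover have rp: "r n > 0" "r (n + 1) > 0"
        using pos[of n] pos[of "n + 1"] n by auto
      ultimately have "r n / r (n + 1) = exp (e n)"
        using exp_ln[of "r n / r (n + 1)"] by simp
      then have "r n = exp (e n) * r (n + 1)"
        using rp(2) by (metis less_irrefl nonzero_eq_divide_eq)
      also have "\<dots> = exp (e n) * (r J * w (n + 1))"
        using step.IH step.prems by simp
      also have "\<dots> = r J * w n"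
        using wrec[OF step.hyps(2)] by simp
      finally show ?case .
    qed
    have "1 = (\<Sum>j=1..J. r j)"
      using r by (simp add: positive_prob_vectors_def)
    also have "\<dots> = r J * W"
      unfolding W_def sum_distrib_left by (rule sum.cong[OF refl], rule rw) auto
    finally have rJ: "r J = 1 / W"
      using \<open>W > 0\<close> by (simp add: field_simps)
    show "r = q"
    proof (rule extensionalityI)
      show "r \<in> extensional {1..J}"
        using r by (simp add: positive_prob_vectors_def)
      show "q \<in> extensional {1..J}"
        by (simp add: q_def)
      fix j assume "j \<in> {1..J}"
      then show "r j = q j"
        using rw[of j] rJ by (simp add: q_def)
    qed
  qed
qed

lemma category_probs:
  assumes "J \<ge> 1"
  shows "category_probs J p pc h hc \<theta> x \<in> positive_prob_vectors J"
    and "adjacent_logit_ppo J p pc h hc \<theta> x (category_probs J p pc h hc \<theta> x)"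
  using theI'[OF ex1_adjacent_logit_ppo[OF assms, of p pc h hc \<theta> x]]
  by (simp_all add: category_probs_def)

lemma param_space_nonempty: "param_space J p pc \<noteq> {}"
  unfolding param_space_def using zero_carrier_vec by blast

lemma bdd_above_likelihood:
  assumes "\<And>\<theta> z. \<theta> \<in> \<Theta> \<Longrightarrow> \<pi> \<theta> z \<in> positive_prob_vectors J"
  shows "bdd_above (likelihood m J x Y \<pi> \<sigma> ` \<Theta>)"
proof (rule bdd_aboveI2)
  fix \<theta> assume "\<theta> \<in> \<Theta>"
  have pr: "0 \<le> \<pi> \<theta> z j \<and> \<pi> \<theta> z j \<le> 1" if j: "j \<in> {1..J}" for z j
  proof -
    have q: "\<pi> \<theta> z \<in> positive_prob_vectors J"
      using assms \<open>\<theta> \<in> \<Theta>\<close> by blast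
    then have "\<pi> \<theta> z j \<le> (\<Sum>k=1..J. \<pi> \<theta> z k)"
      using j by (intro member_le_sum) (auto simp: positive_prob_vectors_def intro: less_imp_le)
    with q j show ?thesis
      by (auto simp: positive_prob_vectors_def intro: less_imp_le)
  qed
  show "likelihood m J x Y \<pi> \<sigma> \<theta> \<le>
      (\<Prod>i=1..m. fact (\<Sum>j=1..J. Y i j) / (\<Prod>j=1..J. fact (Y i (\<sigma> j))))"
    unfolding likelihood_def
  proof (rule prod_mono, intro conjI)
    fix i
    have c: "0 \<le> fact (\<Sum>j=1..J. Y i j) / (\<Prod>j=1..J. fact (Y i (\<sigma> j)) :: real)"
      by (intro divide_nonneg_nonneg prod_nonneg) auto
    have u: "0 \<le> (\<Prod>j=1..J. \<pi> \<theta> (x i) j ^ Y i (\<sigma> j))"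
      using pr by (intro prod_nonneg) auto
    have v: "(\<Prod>j=1..J. \<pi> \<theta> (x i) j ^ Y i (\<sigma> j)) \<le> 1"
      using pr by (intro prod_le_1) (auto intro: power_le_one)
    show "0 \<le> fact (\<Sum>j=1..J. Y i j) / (\<Prod>j=1..J. fact (Y i (\<sigma> j)))
        * (\<Prod>j=1..J. \<pi> \<theta> (x i) j ^ Y i (\<sigma> j))"
      using c u by (rule mult_nonneg_nonneg)
    show "fact (\<Sum>j=1..J. Y i j) / (\<Prod>j=1..J. fact (Y i (\<sigma> j)))
        * (\<Prod>j=1..J. \<pi> \<theta> (x i) j ^ Y i (\<sigma> j))
        \<le> fact (\<Sum>j=1..J. Y i j) / (\<Prod>j=1..J. fact (Y i (\<sigma> j)))"
      using mult_left_mono[OF v c] by simp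
  qed
qed

end

theory Submission imports Defs begin

text \<open>Reversing the categories negates every adjacent-categories logit and moves the one in
  position \<open>j\<close> to position \<open>J - j\<close>.  Since the category-specific predictors coincide
  at the observed settings, the probabilities reversed at all settings simultaneously are again
  those of the model, with the parameter whose blocks are \<open>-\<beta>\<^bsub>J-j\<^esub>\<close> and
  \<open>-\<zeta>\<close>.  So both orders have the same set of likelihood values.\<close>

text \<open>Blocks are counted from 1, so block \<open>j\<close> starts at the same offset that
  \<open>beta_block\<close> reads from.\<close>

primrec concat_blocks :: "(nat \<Rightarrow> real vec) \<Rightarrow> nat \<Rightarrow> real vec" where
  "concat_blocks b 0 = vNil"
| "concat_blocks b (Suc n) = concat_blocks b n @\<^sub>v b (Suc n)"

lemma dim_concat_blocks: "dim_vec (concat_blocks b n) = (\<Sum>j=1..n. dim_vec (b j))"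
  by (induction n) auto

lemma block_index_less:
  fixes p :: "nat \<Rightarrow> nat"
  assumes "j \<in> {1..n}" "k < p j"
  shows "(\<Sum>l=1..<j. p l) + k < (\<Sum>l=1..n. p l)"
proof -
  have "(\<Sum>l=1..<j. p l) + k < (\<Sum>l=1..<Suc j. p l)"
    using assms by simp
  also have "\<dots> \<le> (\<Sum>l=1..n. p l)"
    using assms by (intro sum_mono2) auto
  finally show ?thesis .
qed

text \<open>In the induction on \<open>n\<close>, block \<open>j\<close> is either the last one,
  which starts where the shorter concatenation ends, or its entries lie inside the shorter
  concatenation.\<close>

lemma index_concat_blocks:
  assumes "j \<in> {1..n}" "k < dim_vec (b j)"
  shows "concat_blocks b n $ ((\<Sum>l=1..<j. dim_vec (b l)) + k) = b j $ k"
  using assms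
proof (induction n)
  case 0
  then show ?case by simp
next
  case (Suc n)
  show ?case
  proof (cases "j = Suc n")
    case True
    have "(\<Sum>l=1..<Suc n. dim_vec (b l)) = dim_vec (concat_blocks b n)"
      by (simp add: dim_concat_blocks atLeastLessThanSuc_atLeastAtMost)
    with True Suc.prems show ?thesis by simp
  next
    case False
    with Suc.prems have j: "j \<in> {1..n}" by simp
    have "(\<Sum>l=1..<j. dim_vec (b l)) + k < dim_vec (concat_blocks b n)"
      using block_index_less[where p = "\<lambda>l. dim_vec (b l)", OF j Suc.prems(2)]
      by (simp add: dim_concat_blocks)
    with Suc.IH[OF j] Suc.prems show ?thesis by simp
  qed
qed

text \<open>Surjectivity of the block decomposition: the blocks of a parameter can be prescribed
  freely, the witness being their concatenation. This supplies the parameter of the reversed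
  model.\<close>

lemma param_with_blocks:
  assumes b: "\<And>j. j \<in> {1..J-1} \<Longrightarrow> b j \<in> carrier_vec (p j)" and z: "z \<in> carrier_vec pc"
  shows "\<exists>\<theta>\<in>param_space J p pc.
    (\<forall>j\<in>{1..J-1}. beta_block p \<theta> j = b j) \<and> zeta_block J p pc \<theta> = z"
proof -
  define c where "c = concat_blocks b (J-1)"
  have dims: "(\<Sum>l=1..<j. dim_vec (b l)) = (\<Sum>l=1..<j. p l)" if "j \<in> {1..J-1}" for j
    using that b by (intro sum.cong) auto
  have dim_c: "dim_vec c = (\<Sum>l=1..J-1. p l)"
    unfolding c_def dim_concat_blocks using b by (intro sum.cong) auto
  have "c @\<^sub>v z \<in> param_space J p pc"
    unfolding param_space_def using z dim_c by (intro carrier_vecI) simp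
  moreover have "zeta_block J p pc (c @\<^sub>v z) = z"
    using z dim_c by (intro eq_vecI) (auto simp: zeta_block_def)
  moreover have "beta_block p (c @\<^sub>v z) j = b j" if j: "j \<in> {1..J-1}" for j
  proof (rule eq_vecI)
    show "dim_vec (beta_block p (c @\<^sub>v z) j) = dim_vec (b j)"
      using b[OF j] by (simp add: beta_block_def)
    fix k assume "k < dim_vec (b j)"
    then have k: "k < p j" and kb: "k < dim_vec (b j)"
      using b[OF j] by auto
    have "(\<Sum>l=1..<j. p l) + k < dim_vec c"
      using block_index_less[of j "J-1" k p] j k dim_c by simp
    then show "beta_block p (c @\<^sub>v z) j $ k = b j $ k"
      using index_concat_blocks[of j "J-1" k b, OF j kb] dims[OF j] k
      by (simp add: beta_block_def c_def)
  qed
  ultimately show ?thesis by blast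
qed

lemma scalar_prod_uminus:
  fixes v w :: "real vec"
  shows "v \<bullet> (- w) = - (v \<bullet> w)"
  by (simp add: scalar_prod_def sum_negf)

text \<open>The reversed probability vector solves the model equations at \<open>\<theta>'\<close>,
  and these have only one solution among the positive probability vectors.\<close>

lemma category_probs_reverse:
  assumes J: "J \<ge> 1"
    and \<beta>: "\<And>j. j \<in> {1..J-1} \<Longrightarrow> beta_block p \<theta>' j = - beta_block p \<theta> (J - j)"
    and \<zeta>: "zeta_block J p pc \<theta>' = - zeta_block J p pc \<theta>"
    and h: "\<And>j. j \<in> {1..J-1} \<Longrightarrow> h j x = h 1 x"
    and j: "j \<in> {1..J}"
  shows "category_probs J p pc h hc \<theta>' x j = category_probs J p pc h hc \<theta> x (J + 1 - j)"
proof -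
  define q where "q = category_probs J p pc h hc \<theta> x"
  \<comment> \<open>The restriction to \<open>{1..J}\<close> makes \<open>r\<close> extensional, as
    membership in \<open>positive_prob_vectors\<close> demands.\<close>
  define r where "r = (\<lambda>j\<in>{1..J}. q (J + 1 - j))"
  have q: "q \<in> positive_prob_vectors J" "adjacent_logit_ppo J p pc h hc \<theta> x q"
    unfolding q_def using category_probs[OF J] by blast+
  have pos: "q k > 0" if "k \<in> {1..J}" for k
    using q(1) that by (simp add: positive_prob_vectors_def)
  have "(\<Sum>k=1..J. r k) = (\<Sum>k=1..J. q (J + 1 - k))"
    by (simp add: r_def)
  also have "\<dots> = (\<Sum>k=1..J. q k)"
    by (rule sum.atLeastAtMost_rev[symmetric])
  finally have r: "r \<in> positive_prob_vectors J"
    using q(1) by (auto simp: positive_prob_vectors_def r_def intro!: pos)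
  have "adjacent_logit_ppo J p pc h hc \<theta>' x r"
    unfolding adjacent_logit_ppo_def
  proof
    fix k assume k: "k \<in> {1..J-1}"
    then have k': "J - k \<in> {1..J-1}" by auto
    have "r k = q (J - k + 1)" "r (k + 1) = q (J - k)"
      using k by (auto simp: r_def Suc_diff_le)
    \<comment> \<open>Reversal swaps numerator and denominator of the ratio at position
      \<open>J - k\<close>, hence the sign.\<close>
    then have "ln (r k / r (k + 1)) = - ln (q (J - k) / q (J - k + 1))"
      using pos[of "J - k"] pos[of "J - k + 1"] k by (auto simp: ln_div)
    also have "\<dots> = - (h (J - k) x \<bullet> beta_block p \<theta> (J - k) + hc x \<bullet> zeta_block J p pc \<theta>)"
      using q(2) k' by (auto simp: adjacent_logit_ppo_def)
    \<comment> \<open>The predictor \<open>h (J - k)\<close> may be traded for \<open>h k\<close>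
      because both agree with \<open>h 1\<close> at \<open>x\<close>.\<close>
    also have "\<dots> = h k x \<bullet> beta_block p \<theta>' k + hc x \<bullet> zeta_block J p pc \<theta>'"
      using h[OF k] h[OF k'] \<beta>[OF k] \<zeta> by (simp add: scalar_prod_uminus)
    finally show "ln (r k / r (k + 1)) = h k x \<bullet> beta_block p \<theta>' k + hc x \<bullet> zeta_block J p pc \<theta>'" .
  qed
  with r have "category_probs J p pc h hc \<theta>' x = r"
    using ex1_adjacent_logit_ppo[OF J, of p pc h hc \<theta>' x] category_probs[OF J, of p pc h hc \<theta>' x]
    by blast
  then show ?thesis
    using j by (simp add: r_def q_def)
qed

text \<open>Substituting \<open>J + 1 - j\<close> for \<open>j\<close> in both inner products
  matches the factors; the total count does not involve the order.\<close>

lemma likelihood_reverse: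
  assumes \<pi>: "\<And>i j. i \<in> {1..m} \<Longrightarrow> j \<in> {1..J} \<Longrightarrow> \<pi> \<theta>' (x i) j = \<pi> \<theta> (x i) (J + 1 - j)"
    and \<sigma>: "\<And>j. j \<in> {1..J} \<Longrightarrow> \<tau> j = \<sigma> (J + 1 - j)"
  shows "likelihood m J x Y \<pi> \<tau> \<theta>' = likelihood m J x Y \<pi> \<sigma> \<theta>"
  unfolding likelihood_def
proof (rule prod.cong[OF refl])
  fix i assume i: "i \<in> {1..m}"
  have "(\<Prod>j=1..J. fact (Y i (\<tau> j)) :: real) = (\<Prod>j=1..J. fact (Y i (\<sigma> (J + 1 - j))))"
    using \<sigma> by (intro prod.cong) auto
  also have "\<dots> = (\<Prod>j=1..J. fact (Y i (\<sigma> j)))"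
    by (rule prod.atLeastAtMost_rev[symmetric])
  finally have 1: "(\<Prod>j=1..J. fact (Y i (\<tau> j)) :: real) = (\<Prod>j=1..J. fact (Y i (\<sigma> j)))" .
  have "(\<Prod>j=1..J. \<pi> \<theta>' (x i) j ^ Y i (\<tau> j))
      = (\<Prod>j=1..J. \<pi> \<theta> (x i) (J + 1 - j) ^ Y i (\<sigma> (J + 1 - j)))"
    using \<sigma> \<pi>[OF i] by (intro prod.cong) auto
  also have "\<dots> = (\<Prod>j=1..J. \<pi> \<theta> (x i) j ^ Y i (\<sigma> j))"
    by (rule prod.atLeastAtMost_rev[symmetric])
  finally show "fact (\<Sum>j=1..J. Y i j) / (\<Prod>j=1..J. fact (Y i (\<tau> j)))
        * (\<Prod>j=1..J. \<pi> \<theta>' (x i) j ^ Y i (\<tau> j))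
      = fact (\<Sum>j=1..J. Y i j) / (\<Prod>j=1..J. fact (Y i (\<sigma> j)))
        * (\<Prod>j=1..J. \<pi> \<theta> (x i) j ^ Y i (\<sigma> j))"
    using 1 by simp
qed

text \<open>Stated as one inclusion, since reversal is an involution and exchanging the two orders
  gives the other.\<close>

lemma likelihood_image_reverse_subset:
  assumes J: "J \<ge> 1"
    and p: "\<And>j. j \<in> {1..J-1} \<Longrightarrow> p j = p 1"
    and h: "\<And>i j. i \<in> {1..m} \<Longrightarrow> j \<in> {1..J-1} \<Longrightarrow> h j (x i) = h 1 (x i)"
    and \<sigma>: "\<And>j. j \<in> {1..J} \<Longrightarrow> \<tau> j = \<sigma> (J + 1 - j)"
  shows "likelihood m J x Y (category_probs J p pc h hc) \<sigma> ` param_space J p pc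
    \<subseteq> likelihood m J x Y (category_probs J p pc h hc) \<tau> ` param_space J p pc"
proof (rule image_subsetI)
  fix \<theta>
  have \<beta>: "- beta_block p \<theta> (J - j) \<in> carrier_vec (p j)" if "j \<in> {1..J-1}" for j
  proof -
    have "J - j \<in> {1..J-1}" using that by auto
    \<comment> \<open>Equal block dimensions allow the block from position \<open>J - j\<close> to
      be placed at position \<open>j\<close>.\<close>
    then have "p (J - j) = p j" using p[of "J - j"] p[OF that] by simp
    then show ?thesis
      by (intro carrier_vecI) (simp add: beta_block_def)
  qed
  have \<zeta>: "- zeta_block J p pc \<theta> \<in> carrier_vec pc"
    by (intro carrier_vecI) (simp add: zeta_block_def)
  obtain \<theta>' where \<theta>': "\<theta>' \<in> param_space J p pc"
    "\<And>j. j \<in> {1..J-1} \<Longrightarrow> beta_block p \<theta>' j = - beta_block p \<theta> (J - j)"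
    "zeta_block J p pc \<theta>' = - zeta_block J p pc \<theta>"
    using param_with_blocks[of J "\<lambda>j. - beta_block p \<theta> (J - j)", OF \<beta> \<zeta>] by blast
  have "likelihood m J x Y (category_probs J p pc h hc) \<tau> \<theta>'
      = likelihood m J x Y (category_probs J p pc h hc) \<sigma> \<theta>"
  proof (rule likelihood_reverse)
    fix i j assume i: "i \<in> {1..m}" and j: "j \<in> {1..J}"
    show "category_probs J p pc h hc \<theta>' (x i) j = category_probs J p pc h hc \<theta> (x i) (J + 1 - j)"
      by (rule category_probs_reverse[where h = h, OF J \<theta>'(2,3) h[OF i] j])
  qed (rule \<sigma>)
  then show "likelihood m J x Y (category_probs J p pc h hc) \<sigma> \<theta>
      \<in> likelihood m J x Y (category_probs J p pc h hc) \<tau> ` param_space J p pc"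
    by (rule image_eqI[OF sym, OF _ \<theta>'(1)])
qed

theorem theorem2p4:
  fixes d m J pc :: nat and p :: "nat \<Rightarrow> nat"
    and x :: "nat \<Rightarrow> real vec" and Y :: "nat \<Rightarrow> nat \<Rightarrow> nat"
    and h :: "nat \<Rightarrow> real vec \<Rightarrow> real vec" and hc :: "real vec \<Rightarrow> real vec"
    and \<sigma>\<^sub>1 \<sigma>\<^sub>2 :: "nat \<Rightarrow> nat"
  assumes "d \<ge> 1" and "m \<ge> 1" and "J \<ge> 3"
    and "\<And>i. i \<in> {1..m} \<Longrightarrow> x i \<in> carrier_vec d"
    and "inj_on x {1..m}"
    and "\<And>i. i \<in> {1..m} \<Longrightarrow> (\<Sum>j=1..J. Y i j) > 0"
    and "\<And>j. j \<in> {1..J-1} \<Longrightarrow> h j \<in> carrier_vec d \<rightarrow> carrier_vec (p j)"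
    and "hc \<in> carrier_vec d \<rightarrow> carrier_vec pc"
    and "\<And>i j. i \<in> {1..m} \<Longrightarrow> j \<in> {1..J-1} \<Longrightarrow> h j (x i) = h 1 (x i)"
    and "\<sigma>\<^sub>1 permutes {1..J}" and "\<sigma>\<^sub>2 permutes {1..J}"
    and "\<And>j. j \<in> {1..J} \<Longrightarrow> \<sigma>\<^sub>2 j = \<sigma>\<^sub>1 (J + 1 - j)"
  shows "equivalent_orders m J x Y (param_space J p pc) (category_probs J p pc h hc) \<sigma>\<^sub>1 \<sigma>\<^sub>2"
proof -
  \<comment> \<open>By \<open>m \<ge> 1\<close> there is a setting \<open>x 1\<close>; the common
    vector \<open>h j (x 1) = h 1 (x 1)\<close> has dimension both \<open>p j\<close> and
    \<open>p 1\<close>.\<close>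
  have p: "p j = p 1" if j: "j \<in> {1..J-1}" for j
  proof -
    have "x 1 \<in> carrier_vec d" "h j (x 1) = h 1 (x 1)"
      using assms(2) by (simp_all add: assms(4) assms(9)[OF _ j])
    moreover have "1 \<in> {1..J-1}" using j by simp
    ultimately show ?thesis
      using assms(7)[OF j] assms(7)[of 1] by (metis Pi_mem carrier_vecD)
  qed
  have \<sigma>: "\<sigma>\<^sub>1 j = \<sigma>\<^sub>2 (J + 1 - j)" if "j \<in> {1..J}" for j
  proof -
    have "J + 1 - j \<in> {1..J}" "J + 1 - (J + 1 - j) = j"
      using that by auto
    then show ?thesis
      using assms(12)[of "J + 1 - j"] by simp
  qed
  have J: "J \<ge> 1" using assms(3) by simp
  \<comment> \<open>The suprema agree because they are taken over the same set of values, whether or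
    not they are attained.\<close>
  have "likelihood m J x Y (category_probs J p pc h hc) \<sigma>\<^sub>1 ` param_space J p pc
      = likelihood m J x Y (category_probs J p pc h hc) \<sigma>\<^sub>2 ` param_space J p pc"
    using likelihood_image_reverse_subset[of J p m h x \<sigma>\<^sub>2 \<sigma>\<^sub>1, OF J p assms(9,12)]
      likelihood_image_reverse_subset[of J p m h x \<sigma>\<^sub>1 \<sigma>\<^sub>2, OF J p assms(9) \<sigma>]
    by (rule equalityI)
  then show ?thesis
    by (simp only: equivalent_orders_def)
qed

end
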